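(* Let $C,\epsilon,L_\star>0$ and let $N\ge0$ be an integer with $$N<\log_5\left(\frac{C\,L_\star}{88\,\epsilon\,(C+1)^2}\right).$$ Then there is an adversarial first-order oracle which answers successive queries $\lambda_1,\dots,\lambda_N\in[0,1]$ by pairs of real numbers, denoted $(g(\lambda_i),g'(\lambda_i))$, the $i$-th answer depending only on $\lambda_1,\dots,\lambda_i$, such that for every sequence of $N$ queries $(\lambda_1,\dots,\lambda_N)$ there exist two $L_\star$-smooth functions $g_1,g_2$ and two sets $I_1,I_2$ with $$g_1(\lambda_i)=g_2(\lambda_i)=g(\lambda_i),\qquad g_1'(\lambda_i)=g_2'(\lambda_i)=g'(\lambda_i)\qquad(1\le i\le N),$$ $$Cg_1(\lambda)+\lambda g_1'(\lambda)\ge\epsilon\ \ \text{for all }\lambda\in I_1,\qquad Cg_2(\lambda)+\lambda g_2'(\lambda)\ge\epsilon\ \ \text{for all }\lambda\in I_2,$$ $$I_1\cup I_2=[0,1].$$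
   Context: The problem is to find $\lambda\in[0,1]$ with $Cg(\lambda)+\lambda g'(\lambda)\le\epsilon$ for an unknown function $g$ with $g(1)=0$, given access to $(g(\lambda_i),g'(\lambda_i))$ at sequentially queried points. "$L_\star$-smooth function" means an element of the class $\{g\in C^1([0,1],\mathbb{R}) : g(1)=0,\ |g'(a)-g'(b)|\le L_\star|a-b|\ \forall a,b\in[0,1]\}$. *)

theory Defs
  imports "HOL-Analysis.Analysis"
begin

(* The derivative of a function on [0,1]; it is one-sided at 0 and at 1, and
   values of g outside [0,1] play no role. *)
definition deriv01 :: "(real \<Rightarrow> real) \<Rightarrow> real \<Rightarrow> real" where
  "deriv01 g x = vector_derivative g (at x within {0..1})"

definition smooth_class :: "real \<Rightarrow> (real \<Rightarrow> real) set" where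
  "smooth_class L = {g.
      (\<forall>x\<in>{0..1}. g differentiable (at x within {0..1})) \<and>
      continuous_on {0..1} (deriv01 g) \<and>
      g 1 = 0 \<and>
      (\<forall>a\<in>{0..1}. \<forall>b\<in>{0..1}. \<bar>deriv01 g a - deriv01 g b\<bar> \<le> L * \<bar>a - b\<bar>)}"

(* A deterministic oracle maps the list of all queries made so far, the current
   one last, to its answer (value, slope) to the current query.  Hence the i-th
   answer to the queries q 1, q 2, ... depends only on q 1, ..., q i. *)
type_synonym first_order_oracle = "real list \<Rightarrow> real \<times> real"

definition answer :: "first_order_oracle \<Rightarrow> (nat \<Rightarrow> real) \<Rightarrow> nat \<Rightarrow> real \<times> real" where
  "answer orc q i = orc (map q [1..<Suc i])"

end

theory Submission
  imports Defs
begin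

text \<open>
  The lower bound is a binary search. Fix \<open>a = 1 - 2 / (3 * (C + 1))\<close>. Two curves satisfy
  \<open>C * g + x * g' \<ge> \<epsilon>\<close>, each on its own range. The lower one is the line
  \<open>3 * \<epsilon> * (x - 1)\<close>, which has the prescribed value \<open>0\<close> at \<open>1\<close> and is admissible on \<open>{a..1}\<close>
  (\<open>line_stationarity\<close>). The upper one is nondecreasing with value at least \<open>\<epsilon> / C\<close>, hence
  admissible on all of \<open>{0..1}\<close> (\<open>up_stationarity\<close>), and it is chosen so that on \<open>{a..1}\<close> it is
  parallel to the lower one. A smooth function can therefore follow the upper curve, descend to
  the lower curve in a short window by subtracting a triangular bump from its slope, and then
  follow the lower curve up to \<open>1\<close>; the inequality can only fail inside the window. Because the
  curves are parallel, the half width \<open>r\<close> of the window does not depend on its position \<open>c\<close>: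
  the bump has height \<open>L * r\<close> and area \<open>L * r\<^sup>2\<close>, which has to be the vertical distance of the
  curves.

  The oracle hides the window. It keeps an interval, at first \<open>{a..1}\<close>, and every query that
  falls into it becomes an endpoint of the remaining interval, in such a way that at least half
  of the length is kept (\<open>window_run\<close>). Queries to the left of what remains are answered by
  the upper curve, the others by the lower curve. After \<open>N\<close> queries the interval has length at
  least \<open>(1 - a) / 2 ^ N\<close>. If this is at least \<open>4 * r\<close>, two windows fit side by side, so that both
  functions agree with all answers while nowhere do both violate the inequality.

  Since \<open>r\<^sup>2\<close> is about \<open>3 * \<epsilon> / (C * L)\<close>, the requirement is a bound on \<open>4 ^ N\<close> by a multiple of
  \<open>C * L / (\<epsilon> * (C + 1)\<^sup>2)\<close>, and the assumption, a bound on \<open>5 ^ N\<close>, implies it as soon as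
  \<open>N \<ge> 1\<close> (\<open>dip_radius_bound\<close>). For \<open>N = 0\<close> the constant \<open>88\<close> alone is too small for this, but
  then the two functions need not agree anywhere: the lower line itself, and the function
  with its window just to the right of \<open>a\<close>, suffice.
\<close>

section \<open>Smooth functions given by their derivative\<close>

lemma smooth_classI:
  assumes "\<And>x. (g has_real_derivative g' x) (at x)"
    and "\<And>x y. \<bar>g' x - g' y\<bar> \<le> L * \<bar>x - y\<bar>"
    and "g 1 = 0"
  shows "g \<in> smooth_class L"
    and "x \<in> {0..1} \<Longrightarrow> deriv01 g x = g' x"
proof -
  have d: "deriv01 g x = g' x" if "x \<in> {0..1}" for x
    unfolding deriv01_def
  proof (rule vector_derivative_within_cbox[where a=0 and b=1, unfolded cbox_interval])
    show "(g has_vector_derivative g' x) (at x within {0..1})"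
      using assms(1)[of x] has_real_derivative_iff_has_vector_derivative
        has_vector_derivative_at_within by blast
  qed (use that in auto)
  then show "x \<in> {0..1} \<Longrightarrow> deriv01 g x = g' x" .
  have diff: "g differentiable (at x within {0..1})" for x
    using assms(1) real_differentiable_def
      differentiable_at_withinI by blast
  have lip: "\<bar>deriv01 g x - deriv01 g y\<bar> \<le> L * \<bar>x - y\<bar>" if "x \<in> {0..1}" "y \<in> {0..1}" for x y
    using that assms(2) by (simp add: d)
  have "0 \<le> L"
    using assms(2)[of 0 1] by simp
  then have "L-lipschitz_on {0..1} (deriv01 g)"
    using lip by (auto simp: lipschitz_on_def dist_real_def)
  then have "continuous_on {0..1} (deriv01 g)"
    by (rule lipschitz_on_continuous_on)
  then show "g \<in> smooth_class L"
    using diff lip assms(3) by (auto simp: smooth_class_def)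
qed

text \<open>The antiderivative of the ramp \<open>max 0 x\<close>: all curves below are sums of its translates, so
  that their slopes are piecewise linear and no integration is needed.\<close>
definition half_sq_pos :: "real \<Rightarrow> real" where
  "half_sq_pos x = (max 0 x)\<^sup>2 / 2"

lemma half_sq_pos_derivative: "(half_sq_pos has_real_derivative max 0 x) (at x)"
proof -
  have "(half_sq_pos has_real_derivative 0) (at 0)"
    unfolding has_field_derivative_iff
  proof (rule Lim_null_comparison)
    show "\<forall>\<^sub>F y in at 0. norm ((half_sq_pos y - half_sq_pos 0) / (y - 0)) \<le> \<bar>y\<bar> / 2"
      by (auto simp: half_sq_pos_def max_def power2_eq_square field_simps)
    show "((\<lambda>y::real. \<bar>y\<bar> / 2) \<longlongrightarrow> 0) (at 0)"
      by (auto intro!: tendsto_eq_intros)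
  qed
  moreover have "(half_sq_pos has_real_derivative x) (at x)" if "x > 0"
  proof (rule has_field_derivative_transform_within_open)
    show "((\<lambda>y. y\<^sup>2 / 2) has_real_derivative x) (at x)"
      by (auto intro!: derivative_eq_intros)
  qed (use that in \<open>auto simp: half_sq_pos_def max_def intro: open_greaterThan[of 0]\<close>)
  moreover have "(half_sq_pos has_real_derivative 0) (at x)" if "x < 0"
  proof (rule has_field_derivative_transform_within_open)
    show "((\<lambda>y::real. 0::real) has_real_derivative 0) (at x)"
      by simp
  qed (use that in \<open>auto simp: half_sq_pos_def max_def intro: open_lessThan[of 0]\<close>)
  ultimately show ?thesis
    by (cases x "0::real" rule: linorder_cases) (auto simp: max_def)
qed

lemma half_sq_pos_derivative_comp [derivative_intros]:
  "(f has_real_derivative D) (at x) \<Longrightarrow>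
    ((\<lambda>x. half_sq_pos (f x)) has_real_derivative max 0 (f x) * D) (at x)"
  using DERIV_chain2[OF half_sq_pos_derivative] by blast

section \<open>The two curves and the descent between them\<close>

text \<open>All curves are divided by \<open>L\<close>, so that slopes are 1-Lipschitz. The upper curve has height
  \<open>h\<close> and slope \<open>0\<close> up to \<open>a - t\<close>; on \<open>{a - t..a}\<close> its slope rises to \<open>t\<close>, the slope of the lower
  line, and stays there. With slope \<open>t\<close> from \<open>0\<close> on it would, for large \<open>C\<close>, be too far above the line
  at \<open>a\<close>.\<close>
definition up :: "real \<Rightarrow> real \<Rightarrow> real \<Rightarrow> real \<Rightarrow> real" where
  "up h a t x = h + half_sq_pos (x - (a - t)) - half_sq_pos (x - a)"

definition up_slope :: "real \<Rightarrow> real \<Rightarrow> real \<Rightarrow> real" where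
  "up_slope a t x = max 0 (x - (a - t)) - max 0 (x - a)"

text \<open>The bracket is the antiderivative of the triangular bump of height \<open>r\<close> over
  \<open>{c - r..c + r}\<close>; to the right of the bump it is the constant \<open>r\<^sup>2\<close>.\<close>
definition dip :: "real \<Rightarrow> real \<Rightarrow> real \<Rightarrow> real \<Rightarrow> real \<Rightarrow> real \<Rightarrow> real" where
  "dip h a t r c x = up h a t x
     - (half_sq_pos (x - (c - r)) - 2 * half_sq_pos (x - c) + half_sq_pos (x - (c + r)))"

definition dip_slope :: "real \<Rightarrow> real \<Rightarrow> real \<Rightarrow> real \<Rightarrow> real \<Rightarrow> real" where
  "dip_slope a t r c x = up_slope a t x
     - (max 0 (x - (c - r)) - 2 * max 0 (x - c) + max 0 (x - (c + r)))"

lemma dip_has_derivative: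
  "(dip h a t r c has_real_derivative dip_slope a t r c x) (at x)"
  unfolding dip_def [abs_def] dip_slope_def up_def up_slope_def
  by (auto intro!: derivative_eq_intros)

text \<open>Since \<open>a \<le> c - r\<close>, the bump begins only after the slope has finished rising on \<open>{a - t..a}\<close>, so
  that each linear piece has gradient \<open>-1\<close>, \<open>0\<close> or \<open>1\<close>. If that rise overlapped with the second
  half of the bump, the gradient there would be \<open>2\<close>.\<close>
lemma dip_slope_lipschitz:
  assumes "0 \<le> t" "0 \<le> r" "a \<le> c - r"
  shows "\<bar>dip_slope a t r c x - dip_slope a t r c y\<bar> \<le> \<bar>x - y\<bar>"
proof -
  have eq: "dip_slope a t r c z =
      min (max 0 (min t (z - (a - t)))) (t - max 0 (r - \<bar>z - c\<bar>))" for z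
  proof (cases "z \<le> a")
    case True
    then show ?thesis
      using assms by (simp add: dip_slope_def up_slope_def)
  next
    case False
    then have "up_slope a t z = t" and "max 0 (min t (z - (a - t))) = t"
      using assms(1) by (auto simp: up_slope_def)
    moreover have "max 0 (z - (c - r)) - 2 * max 0 (z - c) + max 0 (z - (c + r)) = max 0 (r - \<bar>z - c\<bar>)"
      using assms(2) by (auto simp: max_def abs_real_def)
    ultimately show ?thesis
      by (simp add: dip_slope_def)
  qed
  have min_lip: "\<bar>min p u - min p' u'\<bar> \<le> d" if "\<bar>p - p'\<bar> \<le> d" "\<bar>u - u'\<bar> \<le> d" for p p' u u' d :: real
    using that by linarith
  show ?thesis
    unfolding eq by (rule min_lip; linarith)
qed

lemma dip_left:
  assumes "0 \<le> r" "x \<le> c - r"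
  shows "dip h a t r c x = up h a t x" and "dip_slope a t r c x = up_slope a t x"
  using assms by (auto simp: dip_def dip_slope_def half_sq_pos_def)

text \<open>The condition on \<open>r\<^sup>2\<close> makes the area of the bump equal to the vertical distance between
  the parallel parts of the curves: at \<open>1\<close> the upper one has height \<open>h + t * (1 - a) + t\<^sup>2 / 2\<close>, the
  last summand being gained on \<open>{a - t..a}\<close>.\<close>
lemma dip_right:
  assumes "0 \<le> t" "0 \<le> r" "a \<le> c - r" "c + r \<le> x" "r\<^sup>2 = h + t * (1 - a) + t\<^sup>2 / 2"
  shows "dip h a t r c x = t * (x - 1)" and "dip_slope a t r c x = t"
  using assms
  by (auto simp: dip_def up_def dip_slope_def up_slope_def half_sq_pos_def max_def power2_eq_square
    field_simps)

lemma up_ge: "0 \<le> t \<Longrightarrow> h \<le> up h a t x"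
  by (simp add: up_def half_sq_pos_def power_mono)

lemma up_slope_nonneg: "0 \<le> t \<Longrightarrow> 0 \<le> up_slope a t x"
  by (simp add: up_slope_def)

lemma up_stationarity:
  assumes "0 \<le> t" "0 \<le> C" "0 \<le> x"
  shows "C * h \<le> C * up h a t x + x * up_slope a t x"
  using mult_left_mono[OF up_ge[OF assms(1)] assms(2)]
    mult_nonneg_nonneg[OF assms(3) up_slope_nonneg[OF assms(1)]]
  by (meson add_increasing2)

text \<open>On the line through \<open>(1, 0)\<close> of slope \<open>3 * s\<close> the expression equals
  \<open>3 * s * (1 - (C + 1) * (1 - x))\<close>, which is at least \<open>s\<close> while \<open>(C + 1) * (1 - x) \<le> 2 / 3\<close>. If
  the line is used from \<open>a = 1 - k / (C + 1)\<close> on, its slope has to be \<open>s / (1 - k)\<close>. For large \<open>C\<close>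
  its distance from the upper curve is then about \<open>s / (C * (1 - k))\<close>, while the square of the
  length of \<open>{a..1}\<close> is proportional to \<open>k\<^sup>2\<close>; the ratio is best where \<open>k\<^sup>2 * (1 - k)\<close> is
  largest, at \<open>k = 2 / 3\<close>.\<close>
lemma line_stationarity:
  fixes C s x :: real
  assumes "C > 0" "0 \<le> s" "1 - 2 / (3 * (C + 1)) \<le> x"
  shows "s \<le> C * (3 * s * (x - 1)) + x * (3 * s)"
proof -
  have "1 \<le> 3 * ((C + 1) * x - C)"
    using assms(1,3) by (simp add: field_simps)
  from mult_left_mono[OF this assms(2)] show ?thesis
    by (simp add: algebra_simps)
qed

section \<open>The bisecting oracle\<close>

text \<open>The endpoint nearer to the query moves to it; \<open>max\<close> and \<open>min\<close> make queries outside the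
  interval change nothing.\<close>
definition bisect :: "real \<times> real \<Rightarrow> real \<Rightarrow> real \<times> real" where
  "bisect w x = (if x \<le> (fst w + snd w) / 2 then (max (fst w) x, snd w) else (fst w, min (snd w) x))"

definition window :: "real \<Rightarrow> real list \<Rightarrow> real \<times> real" where
  "window a xs = foldl bisect (a, 1) xs"

text \<open>The last two claims are what makes the answers consistent: the intervals are nested, so the
  side on which a query lies when it is answered is its side for good, and one comparison with
  the left endpoint decides it.\<close>
lemma window_run:
  fixes q :: "nat \<Rightarrow> real" and a :: real
  defines "W \<equiv> \<lambda>i. window a (map q [1..<Suc i])"
  assumes "a \<le> 1"
  shows "a \<le> fst (W n)" and "snd (W n) \<le> 1" and "(1 - a) / 2 ^ n \<le> snd (W n) - fst (W n)"
    and "1 \<le> i \<Longrightarrow> i \<le> n \<Longrightarrow> q i \<le> fst (W i) \<Longrightarrow> q i \<le> fst (W n)"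
    and "1 \<le> i \<Longrightarrow> i \<le> n \<Longrightarrow> \<not> q i \<le> fst (W i) \<Longrightarrow> snd (W n) \<le> q i"
proof -
  have W0: "W 0 = (a, 1)"
    by (simp add: W_def window_def)
  have WS: "W (Suc i) = bisect (W i) (q (Suc i))" for i
    by (simp add: W_def window_def)
  have len: "(1 - a) / 2 ^ n \<le> snd (W n) - fst (W n)" for n
  proof (induction n)
    case (Suc n)
    have "(snd (W n) - fst (W n)) / 2 \<le> snd (W (Suc n)) - fst (W (Suc n))"
      if "fst (W n) \<le> snd (W n)"
      using that by (auto simp: WS bisect_def field_simps max_def min_def)
    moreover have "0 \<le> (1 - a) / 2 ^ n"
      using assms(2) by simp
    ultimately show ?case
      using Suc by simp
  qed (simp add: W0)
  then show "(1 - a) / 2 ^ n \<le> snd (W n) - fst (W n)" .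
  have up: "fst (W i) \<le> fst (W j)" if "i \<le> j" for i j
    by (rule lift_Suc_mono_le[OF _ that]) (auto simp: WS bisect_def)
  have down: "snd (W j) \<le> snd (W i)" if "i \<le> j" for i j
    by (rule lift_Suc_antimono_le[OF _ that]) (auto simp: WS bisect_def)
  show "a \<le> fst (W n)" "snd (W n) \<le> 1"
    using up[of 0 n] down[of 0 n] by (simp_all add: W0)
  show "q i \<le> fst (W n)" if "1 \<le> i" "i \<le> n" "q i \<le> fst (W i)"
    using that up[of i n] by simp
  show "snd (W n) \<le> q i" if "1 \<le> i" "i \<le> n" "\<not> q i \<le> fst (W i)"
  proof -
    obtain j where j: "i = Suc j"
      using \<open>1 \<le> i\<close> by (cases i) auto
    have "snd (W i) \<le> q i"
      using that(3) by (auto simp: j WS bisect_def split: if_splits)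
    then show ?thesis
      using down[OF \<open>i \<le> n\<close>] by simp
  qed
qed

section \<open>The width of the descent\<close>

text \<open>With \<open>y = \<epsilon> / (C * L)\<close> the three summands of \<open>r\<^sup>2\<close> are \<open>y\<close>, at most \<open>2 * y\<close>, and a
  correction of order \<open>C\<^sup>2 * y\<^sup>2\<close>. For \<open>N \<ge> 1\<close> the assumption gives \<open>C\<^sup>2 * y \<le> 1 / 440\<close>, and the gain
  \<open>4 ^ N \<le> 4 / 5 * 5 ^ N\<close> leaves just enough room for \<open>16 * 4 ^ N * r\<^sup>2 \<le> w\<^sup>2\<close>.\<close>
lemma dip_radius_bound:
  fixes C \<epsilon> L :: real
  assumes "C > 0" "\<epsilon> > 0" "L > 0" "real N < log 5 (C * L / (88 * \<epsilon> * (C + 1)\<^sup>2))"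
  defines "w \<equiv> 2 / (3 * (C + 1))" and "t \<equiv> 3 * \<epsilon> / L"
  defines "r \<equiv> sqrt (\<epsilon> / (C * L) + t * w + t\<^sup>2 / 2)"
  shows "2 * r \<le> w" and "N \<ge> 1 \<Longrightarrow> 4 * r \<le> w / 2 ^ N"
proof -
  define y where "y = \<epsilon> / (C * L)"
  have y: "y > 0"
    using assms by (simp add: y_def)
  have t: "t = 3 * C * y"
    using assms(1,3) by (simp add: t_def y_def)
  have "5 powr real N < C * L / (88 * \<epsilon> * (C + 1)\<^sup>2)"
    using assms(1-4) by (subst (asm) less_log_iff) auto
  then have "5 ^ N < C * L / (88 * \<epsilon> * (C + 1)\<^sup>2)"
    by (simp add: powr_realpow)
  then have hyp: "88 * 5 ^ N * y * (C + 1)\<^sup>2 < 1"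
    using assms(1-3) by (simp add: y_def field_simps)
  have C2: "C\<^sup>2 \<le> (C + 1)\<^sup>2"
    using assms(1) by (simp add: power_mono)
  have "88 * y * (C + 1)\<^sup>2 \<le> 88 * 5 ^ N * y * (C + 1)\<^sup>2"
    using y by (intro mult_right_mono) auto
  then have y88: "88 * y * (C + 1)\<^sup>2 < 1"
    using hyp by simp
  have r2: "r\<^sup>2 = y * (1 + 2 * C / (C + 1) + 9 / 2 * (C\<^sup>2 * y))"
  proof -
    have "r\<^sup>2 = y + t * w + t\<^sup>2 / 2"
      using y assms(1) unfolding r_def y_def[symmetric] by (subst real_sqrt_pow2) (auto simp: t w_def)
    also have "\<dots> = y * (1 + 2 * C / (C + 1) + 9 / 2 * (C\<^sup>2 * y))"
      using assms(1) by (simp add: t w_def power2_eq_square field_simps)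
    finally show ?thesis .
  qed
  have frac: "2 * C / (C + 1) \<le> 2"
    using assms(1) by (simp add: field_simps)
  have wC: "w * (C + 1) = 2 / 3"
    using assms(1) by (simp add: w_def field_simps)
  have w: "w > 0" "w\<^sup>2 * (C + 1)\<^sup>2 = 4 / 9"
    using assms(1)
    by (simp add: w_def) (simp only: power_mult_distrib [symmetric] wC, simp add: power_divide)
  have K: "(C + 1)\<^sup>2 > 0"
    using assms(1) by simp
  \<comment> \<open>Here \<open>352 / 9 = 88 * (4 / 9)\<close>, with \<open>4 / 9 = w\<^sup>2 * (C + 1)\<^sup>2\<close>.\<close>
  have main: "b * r \<le> w"
    if e: "9 / 2 * (C\<^sup>2 * y) \<le> e" and b: "b\<^sup>2 * (3 + e) \<le> 352 / 9 * 5 ^ N" for b e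
  proof (rule power2_le_imp_le)
    have "r\<^sup>2 \<le> y * (3 + e)"
      unfolding r2 using frac e y by (intro mult_left_mono) auto
    then have "b\<^sup>2 * r\<^sup>2 \<le> b\<^sup>2 * (y * (3 + e))"
      by (rule mult_left_mono) simp
    also have "\<dots> = y * (b\<^sup>2 * (3 + e))"
      by simp
    also have "\<dots> \<le> y * (352 / 9 * 5 ^ N)"
      using b y by (intro mult_left_mono) auto
    finally have "b\<^sup>2 * r\<^sup>2 * (C + 1)\<^sup>2 \<le> y * (352 / 9 * 5 ^ N) * (C + 1)\<^sup>2"
      by (rule mult_right_mono) simp
    also have "\<dots> \<le> w\<^sup>2 * (C + 1)\<^sup>2"
      unfolding w(2) using hyp by (simp add: algebra_simps)
    finally show "(b * r)\<^sup>2 \<le> w\<^sup>2"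
      using K by (simp add: power_mult_distrib)
  qed (use w in simp)
  have Cy: "C\<^sup>2 * y \<le> (C + 1)\<^sup>2 * y"
    using C2 y by (intro mult_right_mono) auto
  show "2 * r \<le> w"
  proof (rule main)
    show "9 / 2 * (C\<^sup>2 * y) \<le> 1"
      using y88 Cy by (simp add: algebra_simps)
    have "(1::real) \<le> 5 ^ N"
      by simp
    then have "16 \<le> (352 / 9 * 5 ^ N :: real)"
      by linarith
    then show "2\<^sup>2 * (3 + 1) \<le> (352 / 9 * 5 ^ N :: real)"
      by simp
  qed
  show "4 * r \<le> w / 2 ^ N" if "N \<ge> 1"
  proof -
    have five: "(5::real) \<le> 5 ^ N"
      using power_increasing[OF that, of "5::real"] by simp
    have "440 * y * (C + 1)\<^sup>2 \<le> 88 * 5 ^ N * y * (C + 1)\<^sup>2"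
      using y five by (intro mult_right_mono) auto
    then have e: "9 / 2 * (C\<^sup>2 * y) \<le> 1 / 90"
      using hyp Cy by (simp add: algebra_simps)
    have "(5::real) * 4 ^ N \<le> 4 * 5 ^ N"
    proof -
      obtain m where "N = Suc m"
        using \<open>N \<ge> 1\<close> by (cases N) auto
      then show ?thesis
        by (simp add: power_mono)
    qed
    then have "16 * 4 ^ N * (271 / 90) \<le> (352 / 9 * 5 ^ N :: real)"
      using five by linarith
    moreover have "(4 * 2 ^ N)\<^sup>2 = (16 * 4 ^ N :: real)"
      by (simp add: power_mult_distrib power2_eq_square flip: power_mult_distrib)
    ultimately have "(4 * 2 ^ N)\<^sup>2 * (3 + 1 / 90) \<le> (352 / 9 * 5 ^ N :: real)"
      by simp
    from main[OF e this] show ?thesis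
      by (simp add: field_simps)
  qed
qed

section \<open>The lower bound\<close>

theorem theoremF5:
  fixes C \<epsilon> L :: real and N :: nat
  assumes "C > 0" and "\<epsilon> > 0" and "L > 0"
    and "real N < log 5 (C * L / (88 * \<epsilon> * (C + 1)\<^sup>2))"
  shows "\<exists>orc :: first_order_oracle.
    \<forall>q :: nat \<Rightarrow> real. (\<forall>i\<in>{1..N}. q i \<in> {0..1}) \<longrightarrow>
      (\<exists>g\<^sub>1 g\<^sub>2 I\<^sub>1 I\<^sub>2.
         g\<^sub>1 \<in> smooth_class L \<and> g\<^sub>2 \<in> smooth_class L \<and>
         (\<forall>i\<in>{1..N}. g\<^sub>1 (q i) = fst (answer orc q i) \<and> g\<^sub>2 (q i) = fst (answer orc q i)) \<and>
         (\<forall>i\<in>{1..N}. deriv01 g\<^sub>1 (q i) = snd (answer orc q i) \<and>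
                     deriv01 g\<^sub>2 (q i) = snd (answer orc q i)) \<and>
         (\<forall>x\<in>I\<^sub>1. C * g\<^sub>1 x + x * deriv01 g\<^sub>1 x \<ge> \<epsilon>) \<and>
         (\<forall>x\<in>I\<^sub>2. C * g\<^sub>2 x + x * deriv01 g\<^sub>2 x \<ge> \<epsilon>) \<and>
         I\<^sub>1 \<union> I\<^sub>2 = {0..1})"
proof -
  define w where "w = 2 / (3 * (C + 1))"
  define a where "a = 1 - w"
  define h where "h = \<epsilon> / (C * L)"
  define t where "t = 3 * \<epsilon> / L"
  define r where "r = sqrt (h + t * w + t\<^sup>2 / 2)"
  have w: "0 < w" "w < 1"
    using assms(1) by (auto simp: w_def field_simps)
  have a: "0 \<le> a" "a \<le> 1"
    using w by (auto simp: a_def)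
  have t: "0 \<le> t" "L * t = 3 * \<epsilon>"
    using assms by (auto simp: t_def)
  have h: "0 \<le> h" "C * (L * h) = \<epsilon>"
    using assms by (auto simp: h_def)
  have r: "0 \<le> r" "r\<^sup>2 = h + t * (1 - a) + t\<^sup>2 / 2"
    using h t w by (auto simp: r_def a_def)
  note rad = dip_radius_bound[OF assms, folded h_def t_def w_def, folded r_def]
  define G where "G = (\<lambda>c x. L * dip h a t r c x)"
  define G' where "G' = (\<lambda>c x. L * dip_slope a t r c x)"
  have G_mem: "G c \<in> smooth_class L" and G_deriv: "x \<in> {0..1} \<Longrightarrow> deriv01 (G c) x = G' c x"
    if "a \<le> c - r" "c + r \<le> 1" for c x
  proof -
    have der: "(G c has_real_derivative G' c x) (at x)" for x
      unfolding G_def G'_def by (rule DERIV_cmult[OF dip_has_derivative])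
    have lip: "\<bar>G' c x - G' c y\<bar> \<le> L * \<bar>x - y\<bar>" for x y
      using mult_left_mono[OF dip_slope_lipschitz[OF t(1) r(1) that(1)], of L x y] assms(3)
      by (simp add: G'_def abs_mult flip: right_diff_distrib)
    have one: "G c 1 = 0"
      using dip_right(1)[OF t(1) r(1) that r(2)] by (simp add: G_def)
    show "G c \<in> smooth_class L" "x \<in> {0..1} \<Longrightarrow> deriv01 (G c) x = G' c x"
      using smooth_classI[OF der lip one] by blast+
  qed
  have left: "G c x = L * up h a t x" "G' c x = L * up_slope a t x" if "x \<le> c - r" for c x
    using dip_left[OF r(1) that] by (simp_all add: G_def G'_def)
  have right: "G c x = 3 * \<epsilon> * (x - 1)" "G' c x = 3 * \<epsilon>" if "a \<le> c - r" "c + r \<le> x" for c x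
    using dip_right[OF t(1) r(1) that r(2)] t(2) by (simp_all add: G_def G'_def flip: mult.assoc)
  have good: "\<epsilon> \<le> C * G c x + x * deriv01 (G c) x"
    if "a \<le> c - r" "c + r \<le> 1" "x \<in> {0..c - r} \<union> {c + r..1}" for c x
  proof -
    have x: "x \<in> {0..1}"
      using that a r(1) by auto
    have "x \<le> c - r \<or> c + r \<le> x"
      using that(3) by auto
    then have "\<epsilon> \<le> C * G c x + x * G' c x"
    proof
      assume 1: "x \<le> c - r"
      have "L * (C * h) \<le> L * (C * up h a t x + x * up_slope a t x)"
        using up_stationarity[OF t(1), of C x h a] assms x by simp
      then show ?thesis
        using h(2) by (simp add: left[OF 1] algebra_simps)
    next
      assume 2: "c + r \<le> x"
      have "a \<le> x"
        using 2 that r(1) by simp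
      then show ?thesis
        using line_stationarity[OF assms(1), of \<epsilon> x] assms(2) that(1)
        by (simp add: right[OF _ 2] a_def w_def)
    qed
    then show ?thesis
      by (simp add: G_deriv[OF that(1,2) x])
  qed
  show ?thesis
  proof (cases "N = 0")
    case True
    define g where "g = (\<lambda>x. 3 * \<epsilon> * (x - 1))"
    have g: "g \<in> smooth_class L" "x \<in> {0..1} \<Longrightarrow> deriv01 g x = 3 * \<epsilon>" for x
    proof -
      have "(g has_real_derivative 3 * \<epsilon>) (at x)" for x
        unfolding g_def by (auto intro!: derivative_eq_intros)
      from smooth_classI[where g'="\<lambda>_. 3 * \<epsilon>" and L=L, OF this] assms(3)
      show "g \<in> smooth_class L" "x \<in> {0..1} \<Longrightarrow> deriv01 g x = 3 * \<epsilon>"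
        by (auto simp: g_def)
    qed
    have c: "a \<le> (a + r) - r" "(a + r) + r \<le> 1"
      using rad(1) by (simp_all add: a_def)
    have "\<forall>x\<in>{0..a}. \<epsilon> \<le> C * G (a + r) x + x * deriv01 (G (a + r)) x"
      using good[OF c] by simp
    moreover have "\<forall>x\<in>{a..1}. \<epsilon> \<le> C * g x + x * deriv01 g x"
      using line_stationarity[OF assms(1), of \<epsilon>] assms(2) a
      by (simp add: g(2)) (simp add: g_def a_def w_def)
    moreover have "{0..a} \<union> {a..1} = {0..1}"
      using a by auto
    ultimately show ?thesis
      using G_mem[OF c] g(1) True by (intro exI allI impI conjI) auto
  next
    case False
    define orc :: first_order_oracle where
      "orc = (\<lambda>xs. if last xs \<le> fst (window a xs)
         then (L * up h a t (last xs), L * up_slope a t (last xs))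
         else (3 * \<epsilon> * (last xs - 1), 3 * \<epsilon>))"
    show ?thesis
    proof (rule exI[of _ orc], intro allI impI)
      fix q :: "nat \<Rightarrow> real"
      assume q: "\<forall>i\<in>{1..N}. q i \<in> {0..1}"
      define p where "p = fst (window a (map q [1..<Suc N]))"
      note run = window_run[OF a(2), where q=q and n=N]
      have p: "a \<le> p" "p + 4 * r \<le> snd (window a (map q [1..<Suc N]))" "p + 4 * r \<le> 1"
        using run(1,2,3) rad(2) False by (auto simp: p_def a_def)
      have ans: "G c (q i) = fst (answer orc q i) \<and> G' c (q i) = snd (answer orc q i)"
        if c: "p + r \<le> c" "c + r \<le> p + 4 * r" and i: "i \<in> {1..N}" for c i
      proof -
        have l: "last (map q [1..<Suc i]) = q i"
          using i by simp
        show ?thesis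
        proof (cases "q i \<le> fst (window a (map q [1..<Suc i]))")
          case True
          then have "q i \<le> c - r"
            using run(4)[of i] i c by (simp add: p_def)
          then show ?thesis
            using True left unfolding answer_def orc_def l by simp
        next
          case False
          then have "c + r \<le> q i"
            using run(5)[of i] i c p by simp
          then show ?thesis
            using False right c p unfolding answer_def orc_def l by simp
        qed
      qed
      have c1: "a \<le> (p + r) - r" "(p + r) + r \<le> 1" and c2: "a \<le> (p + 3 * r) - r" "(p + 3 * r) + r \<le> 1"
        using p r(1) by auto
      \<comment> \<open>The excluded windows \<open>{p<..<p + 2 * r}\<close> and \<open>{p + 2 * r<..<p + 4 * r}\<close> are disjoint.\<close>
      let ?I1 = "{0..(p + r) - r} \<union> {(p + r) + r..1}"
      let ?I2 = "{0..(p + 3 * r) - r} \<union> {(p + 3 * r) + r..1}"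
      have "?I1 \<union> ?I2 = {0..1}"
        using p a r(1) by auto
      then show "\<exists>g\<^sub>1 g\<^sub>2 I\<^sub>1 I\<^sub>2.
         g\<^sub>1 \<in> smooth_class L \<and> g\<^sub>2 \<in> smooth_class L \<and>
         (\<forall>i\<in>{1..N}. g\<^sub>1 (q i) = fst (answer orc q i) \<and> g\<^sub>2 (q i) = fst (answer orc q i)) \<and>
         (\<forall>i\<in>{1..N}. deriv01 g\<^sub>1 (q i) = snd (answer orc q i) \<and>
                     deriv01 g\<^sub>2 (q i) = snd (answer orc q i)) \<and>
         (\<forall>x\<in>I\<^sub>1. C * g\<^sub>1 x + x * deriv01 g\<^sub>1 x \<ge> \<epsilon>) \<and>
         (\<forall>x\<in>I\<^sub>2. C * g\<^sub>2 x + x * deriv01 g\<^sub>2 x \<ge> \<epsilon>) \<and>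
         I\<^sub>1 \<union> I\<^sub>2 = {0..1}"
        using G_mem[OF c1] G_mem[OF c2] good[OF c1] good[OF c2]
          ans[of "p + r"] ans[of "p + 3 * r"] r(1) q
        by (intro exI[of _ "G (p + r)"] exI[of _ "G (p + 3 * r)"] exI[of _ ?I1] exI[of _ ?I2])
          (simp add: G_deriv[OF c1] G_deriv[OF c2])
    qed
  qed
qed

end
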